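(* Let $(T_1,T_2)$ be a compatible $\mathcal{O}$-operator on an $A$-bimodule $M$ over an associative algebra $A$. Then the map $$\Theta:C^\bullet_{\mathrm{cO}}(M,A)\to C^\bullet_{\mathrm{O}}(M,A),\qquad \Theta((f_1,\ldots,f_{n+1}))=f_1+\cdots+f_{n+1},\quad n\ge0,$$ induces a morphism $H^\bullet_{(T_1,T_2)}(M,A)\to H^\bullet_{T_1+T_2}(M,A)$ from the cohomology of the compatible $\mathcal{O}$-operator $(T_1,T_2)$ to the cohomology of the total $\mathcal{O}$-operator $T_1+T_2$.
   Context: All vector spaces are over a field $\mathbf{k}$ of characteristic $0$; $\cdot$ denotes the product of $A$ and both actions on $M$. An $\mathcal{O}$-operator on $M$ over $A$ is a linear map $T:M\to A$ with $T(u)\cdot T(v)=T(T(u)\cdot v+u\cdot T(v))$ for all $u,v\in M$. A compatible $\mathcal{O}$-operator is a pair $(T_1,T_2)$ of $\mathcal{O}$-operators such that for all $u,v\in M$ $$T_1(u)\cdot T_2(v)+T_2(u)\cdot T_1(v)=T_1(T_2(u)\cdot v+u\cdot T_2(v))+T_2(T_1(u)\cdot v+u\cdot T_1(v)).$$ Then $T_1+T_2$ is an $\mathcal{O}$-operator, called the total $\mathcal{O}$-operator. Let $C^n_{\mathrm{O}}(M,A)=\mathrm{Hom}(M^{\otimes n},A)$ for $n\ge0$ (so $C^0_{\mathrm O}(M,A)=A$). For linear $T:M\to A$, $a\in A$, and $f\in\mathrm{Hom}(M^{\otimes n},A)$, $n\ge1$, put $$[T,a](u)=T(a\cdot u-u\cdot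 a)+T(u)\cdot a-a\cdot T(u),$$ $$[T,f](u_1,\ldots,u_{n+1})=T(f(u_1,\ldots,u_n)\cdot u_{n+1})-(-1)^nT(u_1\cdot f(u_2,\ldots,u_{n+1}))$$ $$-(-1)^n\Big\{\sum_{i=1}^n(-1)^{i-1}f(u_1,\ldots,u_{i-1},T(u_i)\cdot u_{i+1},u_{i+2},\ldots,u_{n+1})-\sum_{i=1}^n(-1)^if(u_1,\ldots,u_{i-1},u_i\cdot T(u_{i+1}),u_{i+2},\ldots,u_{n+1})\Big\}$$ $$+(-1)^n\big\{T(u_1)\cdot f(u_2,\ldots,u_{n+1})-(-1)^nf(u_1,\ldots,u_n)\cdot T(u_{n+1})\big\}.$$ For an $\mathcal{O}$-operator $T$, $\delta_T:=[T,-]:C^n_{\mathrm{O}}\to C^{n+1}_{\mathrm{O}}$ is a differential; its cohomology, the cohomology of $T$, is denoted $H^\bullet_T(M,A)$. Let $C^0_{\mathrm{cO}}(M,A)=A$ and, for $n\ge1$, let $C^n_{\mathrm{cO}}(M,A)$ be the direct sum of $n+1$ copies of $\mathrm{Hom}(M^{\otimes n},A)$. For a compatible $\mathcal{O}$-operator $(T_1,T_2)$ the differential $\delta_{(T_1,T_2)}:C^n_{\mathrm{cO}}\to C^{n+1}_{\mathrm{cO}}$ is $\delta_{(T_1,T_2)}(a)=([T_1,a],[T_2,a])$ and $$\delta_{(T_1,T_2)}((f_1,\ldots,f_{n+1}))=\big([T_1,f_1],\ldots,\underbrace{[T_1,f_i]+[T_2,f_{i-1}]}_{i\text{-th place}},\ldots,[T_2,f_{n+1}]\big).$$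 Its cohomology, the cohomology of $(T_1,T_2)$, is denoted $H^\bullet_{(T_1,T_2)}(M,A)$. *)

theory Defs
  imports Complex_Main "HOL-Library.Function_Algebras"
begin

text \<open>
  The algebra \<open>A\<close> is a type of class \<^class>\<open>ring\<close> (associative, no unit required) with a scalar
  multiplication \<open>sA\<close>; \<open>M\<close> is an abelian group with scalar multiplication \<open>sM\<close>, left action
  \<open>lact a u\<close> and right action \<open>ract u a\<close>.
\<close>

locale assoc_algebra = vector_space sA
  for sA :: "'k::field_char_0 \<Rightarrow> 'a::ring \<Rightarrow> 'a" +
  assumes scale_mult_left: "sA c a * b = sA c (a * b)"
    and scale_mult_right: "a * sA c b = sA c (a * b)"

locale algebra_bimodule = A: assoc_algebra sA + M: vector_space sM
  for sA :: "'k::field_char_0 \<Rightarrow> 'a::ring \<Rightarrow> 'a"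
    and sM :: "'k \<Rightarrow> 'm::ab_group_add \<Rightarrow> 'm"
    and lact :: "'a \<Rightarrow> 'm \<Rightarrow> 'm"
    and ract :: "'m \<Rightarrow> 'a \<Rightarrow> 'm" +
  assumes lact_linear_left: "Vector_Spaces.linear sA sM (\<lambda>a. lact a u)"
    and lact_linear_right: "Vector_Spaces.linear sM sM (lact a)"
    and ract_linear_left: "Vector_Spaces.linear sM sM (\<lambda>u. ract u a)"
    and ract_linear_right: "Vector_Spaces.linear sA sM (ract u)"
    and lact_assoc: "lact (a * b) u = lact a (lact b u)"
    and ract_assoc: "ract u (a * b) = ract (ract u a) b"
    and lact_ract_assoc: "ract (lact a u) b = lact a (ract u b)"

definition o_operator ::
  "('k::field_char_0 \<Rightarrow> 'a::ring \<Rightarrow> 'a) \<Rightarrow> ('k \<Rightarrow> 'm::ab_group_add \<Rightarrow> 'm) \<Rightarrow>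
   ('a \<Rightarrow> 'm \<Rightarrow> 'm) \<Rightarrow> ('m \<Rightarrow> 'a \<Rightarrow> 'm) \<Rightarrow> ('m \<Rightarrow> 'a) \<Rightarrow> bool" where
  "o_operator sA sM lact ract T \<longleftrightarrow>
     Vector_Spaces.linear sM sA T \<and>
     (\<forall>u v. T u * T v = T (lact (T u) v + ract u (T v)))"

definition compatible_o_operator ::
  "('k::field_char_0 \<Rightarrow> 'a::ring \<Rightarrow> 'a) \<Rightarrow> ('k \<Rightarrow> 'm::ab_group_add \<Rightarrow> 'm) \<Rightarrow>
   ('a \<Rightarrow> 'm \<Rightarrow> 'm) \<Rightarrow> ('m \<Rightarrow> 'a \<Rightarrow> 'm) \<Rightarrow> ('m \<Rightarrow> 'a) \<Rightarrow> ('m \<Rightarrow> 'a) \<Rightarrow> bool" where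
  "compatible_o_operator sA sM lact ract T1 T2 \<longleftrightarrow>
     o_operator sA sM lact ract T1 \<and> o_operator sA sM lact ract T2 \<and>
     (\<forall>u v. T1 u * T2 v + T2 u * T1 v =
        T1 (lact (T2 u) v + ract u (T2 v)) + T2 (lact (T1 u) v + ract u (T1 v)))"

lemma total_o_operator:
  assumes "algebra_bimodule sA sM lact ract"
    and "compatible_o_operator sA sM lact ract T1 T2"
  shows "o_operator sA sM lact ract (T1 + T2)"
proof -
  interpret algebra_bimodule sA sM lact ract by fact
  have lin1: "Vector_Spaces.linear sM sA T1" and lin2: "Vector_Spaces.linear sM sA T2"
    and T1: "\<And>u v. T1 u * T1 v = T1 (lact (T1 u) v + ract u (T1 v))"
    and T2: "\<And>u v. T2 u * T2 v = T2 (lact (T2 u) v + ract u (T2 v))"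
    and T12: "\<And>u v. T1 u * T2 v + T2 u * T1 v =
        T1 (lact (T2 u) v + ract u (T2 v)) + T2 (lact (T1 u) v + ract u (T1 v))"
    using assms(2) by (auto simp: compatible_o_operator_def o_operator_def)
  interpret vector_space_pair sM sA ..
  have lin: "Vector_Spaces.linear sM sA (T1 + T2)"
    using linear_compose_add[OF lin1 lin2] by (simp add: plus_fun_def)
  have l: "lact (a + b) v = lact a v + lact b v"
    and r: "ract v (a + b) = ract v a + ract v b" for a b v
    using lact_linear_left[of v] ract_linear_right[of v]
    by (auto dest: Vector_Spaces.linear.axioms(3) simp: linear_iff module_hom_iff)
  have "(T1 u + T2 u) * (T1 v + T2 v) =
      T1 u * T1 v + T2 u * T2 v + (T1 u * T2 v + T2 u * T1 v)" for u v
    by (simp add: algebra_simps)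
  then show ?thesis
    unfolding o_operator_def T1 T2 T12
    using lin by (simp add: l r linear_add[OF lin1] linear_add[OF lin2] algebra_simps)
qed

text \<open>
  \<open>Hom(M\<^sup>\<otimes>\<^sup>n, A)\<close> is identified, by the universal property of the tensor power, with the
  \<open>n\<close>-linear maps from \<open>M\<close> to \<open>A\<close>. Such a map is encoded as a function on lists, set to 0 on
  lists of length other than \<open>n\<close> so that equality of cochains is equality of functions. For
  \<open>n = 0\<close> the cochain \<open>f\<close> is the element \<open>f []\<close> of \<open>A\<close>.
\<close>

definition o_cochains ::
  "('k::field_char_0 \<Rightarrow> 'a::ring \<Rightarrow> 'a) \<Rightarrow> ('k \<Rightarrow> 'm::ab_group_add \<Rightarrow> 'm) \<Rightarrow>
   nat \<Rightarrow> ('m list \<Rightarrow> 'a) set" where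
  "o_cochains sA sM n = {f.
     (\<forall>us. length us = n \<longrightarrow> (\<forall>i<n. Vector_Spaces.linear sM sA (\<lambda>u. f (us[i := u])))) \<and>
     (\<forall>us. length us \<noteq> n \<longrightarrow> f us = 0)}"

text \<open>
  The bracket \<open>[T, f]\<close> for an \<open>n\<close>-cochain \<open>f\<close>. The argument \<open>u\<^sub>j\<close> is \<open>us ! (j - 1)\<close>.
\<close>

fun o_bracket ::
  "('k::field_char_0 \<Rightarrow> 'a::ring \<Rightarrow> 'a) \<Rightarrow> ('a \<Rightarrow> 'm::ab_group_add \<Rightarrow> 'm) \<Rightarrow>
   ('m \<Rightarrow> 'a \<Rightarrow> 'm) \<Rightarrow> ('m \<Rightarrow> 'a) \<Rightarrow> nat \<Rightarrow> ('m list \<Rightarrow> 'a) \<Rightarrow> ('m list \<Rightarrow> 'a)" where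
  "o_bracket sA lact ract T 0 f = (\<lambda>us.
     if length us = 1 then
       (let a = f []; u = us ! 0 in T (lact a u - ract u a) + T u * a - a * T u)
     else 0)"
| "o_bracket sA lact ract T (Suc m) f = (\<lambda>us.
     let n = Suc m in
     if length us = n + 1 then
       T (lact (f (take n us)) (us ! n))
       - sA ((- 1) ^ n) (T (ract (us ! 0) (f (drop 1 us))))
       - sA ((- 1) ^ n)
           ((\<Sum>i = 1..n. sA ((- 1) ^ (i - 1))
               (f (take (i - 1) us @ [lact (T (us ! (i - 1))) (us ! i)] @ drop (i + 1) us)))
            - (\<Sum>i = 1..n. sA ((- 1) ^ i)
               (f (take (i - 1) us @ [ract (us ! (i - 1)) (T (us ! i))] @ drop (i + 1) us))))
       + sA ((- 1) ^ n)
           (T (us ! 0) * f (drop 1 us) - sA ((- 1) ^ n) (f (take n us) * T (us ! n)))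
     else 0)"

text \<open>
  An element \<open>(f\<^sub>1, \<dots>, f\<^sub>n\<^sub>+\<^sub>1)\<close> of the direct sum of \<open>n + 1\<close> copies of \<open>Hom(M\<^sup>\<otimes>\<^sup>n, A)\<close> is
  encoded as a sequence \<open>F\<close> with \<open>F i = f\<^sub>i\<^sub>+\<^sub>1\<close> for \<open>i \<le> n\<close> and \<open>F i = 0\<close> for \<open>i > n\<close>. In degree 0
  this is a single copy of \<open>A\<close>.
\<close>

definition co_cochains ::
  "('k::field_char_0 \<Rightarrow> 'a::ring \<Rightarrow> 'a) \<Rightarrow> ('k \<Rightarrow> 'm::ab_group_add \<Rightarrow> 'm) \<Rightarrow>
   nat \<Rightarrow> (nat \<Rightarrow> 'm list \<Rightarrow> 'a) set" where
  "co_cochains sA sM n = {F. (\<forall>i\<le>n. F i \<in> o_cochains sA sM n) \<and> (\<forall>i>n. F i = 0)}"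

definition co_diff ::
  "('k::field_char_0 \<Rightarrow> 'a::ring \<Rightarrow> 'a) \<Rightarrow> ('a \<Rightarrow> 'm::ab_group_add \<Rightarrow> 'm) \<Rightarrow>
   ('m \<Rightarrow> 'a \<Rightarrow> 'm) \<Rightarrow> ('m \<Rightarrow> 'a) \<Rightarrow> ('m \<Rightarrow> 'a) \<Rightarrow>
   nat \<Rightarrow> (nat \<Rightarrow> 'm list \<Rightarrow> 'a) \<Rightarrow> (nat \<Rightarrow> 'm list \<Rightarrow> 'a)" where
  "co_diff sA lact ract T1 T2 n F = (\<lambda>i.
     if i = 0 then o_bracket sA lact ract T1 n (F 0)
     else if i \<le> n then
       o_bracket sA lact ract T1 n (F i) + o_bracket sA lact ract T2 n (F (i - 1))
     else if i = n + 1 then o_bracket sA lact ract T2 n (F n)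
     else 0)"

definition total_map :: "nat \<Rightarrow> (nat \<Rightarrow> 'm list \<Rightarrow> 'a::ring) \<Rightarrow> ('m list \<Rightarrow> 'a)" where
  "total_map n F = (\<Sum>i\<le>n. F i)"

definition fun_scale :: "('k \<Rightarrow> 'a \<Rightarrow> 'a) \<Rightarrow> 'k \<Rightarrow> ('x \<Rightarrow> 'a) \<Rightarrow> ('x \<Rightarrow> 'a)" where
  "fun_scale s c f = (\<lambda>x. s c (f x))"

lemma vector_space_fun_scale: "vector_space s \<Longrightarrow> vector_space (fun_scale s)"
  unfolding vector_space_def fun_scale_def by (auto simp: fun_eq_iff)

text \<open>
  Cohomology of a complex given by subspaces \<open>C n\<close> of a vector space and maps \<open>d n\<close> from \<open>C n\<close> to
  \<open>C (n + 1)\<close>, as the quotient of cocycles by coboundaries.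
\<close>

definition cocycles ::
  "(nat \<Rightarrow> 'c::ab_group_add set) \<Rightarrow> (nat \<Rightarrow> 'c \<Rightarrow> 'c) \<Rightarrow> nat \<Rightarrow> 'c set" where
  "cocycles C d n = {f \<in> C n. d n f = 0}"

fun coboundaries ::
  "(nat \<Rightarrow> 'c::ab_group_add set) \<Rightarrow> (nat \<Rightarrow> 'c \<Rightarrow> 'c) \<Rightarrow> nat \<Rightarrow> 'c set" where
  "coboundaries C d 0 = {0}"
| "coboundaries C d (Suc n) = d n ` C n"

definition cohomologous ::
  "(nat \<Rightarrow> 'c::ab_group_add set) \<Rightarrow> (nat \<Rightarrow> 'c \<Rightarrow> 'c) \<Rightarrow> nat \<Rightarrow> ('c \<times> 'c) set" where
  "cohomologous C d n =
     {(f, g). f \<in> cocycles C d n \<and> g \<in> cocycles C d n \<and> f - g \<in> coboundaries C d n}"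

definition cohomology ::
  "(nat \<Rightarrow> 'c::ab_group_add set) \<Rightarrow> (nat \<Rightarrow> 'c \<Rightarrow> 'c) \<Rightarrow> nat \<Rightarrow> 'c set set" where
  "cohomology C d n = cocycles C d n // cohomologous C d n"

definition cohomology_class ::
  "(nat \<Rightarrow> 'c::ab_group_add set) \<Rightarrow> (nat \<Rightarrow> 'c \<Rightarrow> 'c) \<Rightarrow> nat \<Rightarrow> 'c \<Rightarrow> 'c set" where
  "cohomology_class C d n f = cohomologous C d n `` {f}"

definition cohomology_add ::
  "(nat \<Rightarrow> 'c::ab_group_add set) \<Rightarrow> (nat \<Rightarrow> 'c \<Rightarrow> 'c) \<Rightarrow> nat \<Rightarrow> 'c set \<Rightarrow> 'c set \<Rightarrow> 'c set" where
  "cohomology_add C d n X Y = (\<Union>f\<in>X. \<Union>g\<in>Y. cohomology_class C d n (f + g))"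

definition cohomology_scale ::
  "('k \<Rightarrow> 'c \<Rightarrow> 'c) \<Rightarrow> (nat \<Rightarrow> 'c::ab_group_add set) \<Rightarrow> (nat \<Rightarrow> 'c \<Rightarrow> 'c) \<Rightarrow> nat \<Rightarrow>
   'k \<Rightarrow> 'c set \<Rightarrow> 'c set" where
  "cohomology_scale s C d n c X = (\<Union>f\<in>X. cohomology_class C d n (s c f))"

definition cohomology_linear ::
  "('k \<Rightarrow> 'c \<Rightarrow> 'c) \<Rightarrow> (nat \<Rightarrow> 'c::ab_group_add set) \<Rightarrow> (nat \<Rightarrow> 'c \<Rightarrow> 'c) \<Rightarrow>
   ('k \<Rightarrow> 'e \<Rightarrow> 'e) \<Rightarrow> (nat \<Rightarrow> 'e::ab_group_add set) \<Rightarrow> (nat \<Rightarrow> 'e \<Rightarrow> 'e) \<Rightarrow>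
   nat \<Rightarrow> ('c set \<Rightarrow> 'e set) \<Rightarrow> bool" where
  "cohomology_linear s C d s' C' d' n \<Phi> \<longleftrightarrow>
     (\<forall>X \<in> cohomology C d n. \<Phi> X \<in> cohomology C' d' n) \<and>
     (\<forall>X \<in> cohomology C d n. \<forall>Y \<in> cohomology C d n.
        \<Phi> (cohomology_add C d n X Y) = cohomology_add C' d' n (\<Phi> X) (\<Phi> Y)) \<and>
     (\<forall>c. \<forall>X \<in> cohomology C d n.
        \<Phi> (cohomology_scale s C d n c X) = cohomology_scale s' C' d' n c (\<Phi> X))"

text \<open>
  \<open>\<theta>\<close> is a cochain map and \<open>[f] \<mapsto> [\<theta> f]\<close> is a well-defined linear map in each degree.
\<close>

definition induces_cohomology_morphism ::
  "('k \<Rightarrow> 'c \<Rightarrow> 'c) \<Rightarrow> (nat \<Rightarrow> 'c::ab_group_add set) \<Rightarrow> (nat \<Rightarrow> 'c \<Rightarrow> 'c) \<Rightarrow>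
   ('k \<Rightarrow> 'e \<Rightarrow> 'e) \<Rightarrow> (nat \<Rightarrow> 'e::ab_group_add set) \<Rightarrow> (nat \<Rightarrow> 'e \<Rightarrow> 'e) \<Rightarrow>
   (nat \<Rightarrow> 'c \<Rightarrow> 'e) \<Rightarrow> bool" where
  "induces_cohomology_morphism s C d s' C' d' \<theta> \<longleftrightarrow>
     (\<forall>n. \<forall>f \<in> C n. \<theta> n f \<in> C' n \<and> d' n (\<theta> n f) = \<theta> (Suc n) (d n f)) \<and>
     (\<exists>\<Phi>. \<forall>n. cohomology_linear s C d s' C' d' n (\<Phi> n) \<and>
        (\<forall>f \<in> cocycles C d n.
           \<Phi> n (cohomology_class C d n f) = cohomology_class C' d' n (\<theta> n f)))"

end

theory Submission imports Defs begin

text \<open>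
  The theorem rests on the bracket \<open>[T, f]\<close> being bilinear. Summing the entries of
  \<open>\<delta>(f\<^sub>1, \<dots>, f\<^sub>n\<^sub>+\<^sub>1)\<close>, every \<open>f\<^sub>i\<close> meets \<open>T\<^sub>1\<close> once (in place \<open>i\<close>) and \<open>T\<^sub>2\<close> once (in place
  \<open>i + 1\<close>), so the sum is
  \<open>\<Sum>\<^sub>i [T\<^sub>1, f\<^sub>i] + \<Sum>\<^sub>i [T\<^sub>2, f\<^sub>i] = [T\<^sub>1, \<Theta> f] + [T\<^sub>2, \<Theta> f] = [T\<^sub>1 + T\<^sub>2, \<Theta> f]\<close>
  and \<open>\<Theta>\<close> commutes with the differentials (lemma \<open>total_map_co_diff\<close>). The first equality is
  linearity in \<open>f\<close>, which comes from the linearity of \<open>T\<close>, of the product and of the actions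
  (\<open>linear_o_bracket\<close>). The second is additivity in \<open>T\<close>; there \<open>T\<close> also occurs inside the
  arguments of \<open>f\<close>, so multilinearity of \<open>f\<close> enters (\<open>o_bracket_add_operator\<close>).

  The passage to cohomology is formal: a linear map commuting with the differentials sends
  cocycles to cocycles and coboundaries to coboundaries, hence acts linearly on the quotients
  (\<open>cochain_map_induces_cohomology_morphism\<close>).
\<close>

section \<open>Maps induced on cohomology\<close>

text \<open>
  A linear differential makes cocycles (a kernel) and coboundaries (an image) subspaces. That is
  what turns \<^const>\<open>cohomologous\<close> into an equivalence relation on cocycles which respects addition
  and scaling, so that one may compute with representatives in \<^const>\<open>cohomology\<close>.
\<close>

locale linear_differential = vector_space s
  for s :: "'k::field \<Rightarrow> 'c::ab_group_add \<Rightarrow> 'c" +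
  fixes C :: "nat \<Rightarrow> 'c set" and d :: "nat \<Rightarrow> 'c \<Rightarrow> 'c"
  assumes subspace_cochains: "subspace (C n)"
    and linear_differential: "Vector_Spaces.linear s s (d n)"
begin

sublocale d: Vector_Spaces.linear s s "d n" for n
  by (rule linear_differential)

lemma subspace_cocycles: "subspace (cocycles C d n)"
  using subspace_cochains[of n]
  by (auto simp: subspace_def cocycles_def d.add d.scale)

lemma subspace_coboundaries: "subspace (coboundaries C d n)"
proof (cases n)
  case 0
  then show ?thesis by simp
next
  case (Suc m)
  then show ?thesis
    using d.subspace_image[OF subspace_cochains] by simp
qed

lemma equiv_cohomologous: "equiv (cocycles C d n) (cohomologous C d n)"
proof (rule equivI)
  show "cohomologous C d n \<subseteq> cocycles C d n \<times> cocycles C d n"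
    by (auto simp: cohomologous_def)
  show "refl_on (cocycles C d n) (cohomologous C d n)"
    using subspace_0[OF subspace_coboundaries]
    by (auto simp: refl_on_def cohomologous_def)
  show "sym (cohomologous C d n)"
    using subspace_neg[OF subspace_coboundaries[of n]]
    by (force simp: sym_def cohomologous_def)
  show "trans (cohomologous C d n)"
    using subspace_add[OF subspace_coboundaries[of n]]
    by (force simp: trans_def cohomologous_def)
qed

lemma cohomology_class_eq_iff:
  assumes "f \<in> cocycles C d n" "g \<in> cocycles C d n"
  shows "cohomology_class C d n f = cohomology_class C d n g \<longleftrightarrow> f - g \<in> coboundaries C d n"
  using eq_equiv_class_iff[OF equiv_cohomologous assms] assms
  by (auto simp: cohomology_class_def cohomologous_def)

lemma cohomology_class_self:
  "f \<in> cocycles C d n \<Longrightarrow> f \<in> cohomology_class C d n f"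
  unfolding cohomology_class_def by (rule equiv_class_self[OF equiv_cohomologous])

lemma mem_cohomology_class_iff:
  "g \<in> cohomology_class C d n f \<longleftrightarrow>
     f \<in> cocycles C d n \<and> g \<in> cocycles C d n \<and> f - g \<in> coboundaries C d n"
  by (auto simp: cohomology_class_def cohomologous_def)

lemma cohomology_class_in_cohomology:
  "f \<in> cocycles C d n \<Longrightarrow> cohomology_class C d n f \<in> cohomology C d n"
  unfolding cohomology_class_def cohomology_def by (rule quotientI)

lemma cohomologyE:
  assumes "X \<in> cohomology C d n"
  obtains f where "f \<in> cocycles C d n" "X = cohomology_class C d n f"
  using assms unfolding cohomology_class_def cohomology_def by (rule quotientE)

text \<open>
  The operations on classes are unions over all representatives. In the next two lemmas these
  unions collapse to one class, since all the sets united are equal.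
\<close>

lemma cohomology_add_class:
  assumes f: "f \<in> cocycles C d n" and g: "g \<in> cocycles C d n"
  shows "cohomology_add C d n (cohomology_class C d n f) (cohomology_class C d n g) =
    cohomology_class C d n (f + g)"
proof -
  have "cohomology_class C d n (f' + g') = cohomology_class C d n (f + g)"
    if f': "f' \<in> cohomology_class C d n f" and g': "g' \<in> cohomology_class C d n g" for f' g'
  proof -
    have "(f - f') + (g - g') \<in> coboundaries C d n"
      using f' g' subspace_add[OF subspace_coboundaries] by (auto simp: mem_cohomology_class_iff)
    then have "(f + g) - (f' + g') \<in> coboundaries C d n"
      by (simp add: algebra_simps)
    then show ?thesis
      using f' g' cohomology_class_eq_iff[of "f + g" n "f' + g'"] subspace_add[OF subspace_cocycles]
      by (auto simp: mem_cohomology_class_iff)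
  qed
  then show ?thesis
    unfolding cohomology_add_def
    using cohomology_class_self[OF f] cohomology_class_self[OF g] by blast
qed

lemma cohomology_scale_class:
  assumes f: "f \<in> cocycles C d n"
  shows "cohomology_scale s C d n c (cohomology_class C d n f) = cohomology_class C d n (s c f)"
proof -
  have "cohomology_class C d n (s c f') = cohomology_class C d n (s c f)"
    if f': "f' \<in> cohomology_class C d n f" for f'
  proof -
    have "s c (f - f') \<in> coboundaries C d n"
      using f' subspace_scale[OF subspace_coboundaries] by (auto simp: mem_cohomology_class_iff)
    then have "s c f - s c f' \<in> coboundaries C d n"
      by (simp add: scale_right_diff_distrib)
    then show ?thesis
      using f' cohomology_class_eq_iff[of "s c f" n "s c f'"] subspace_scale[OF subspace_cocycles]
      by (auto simp: mem_cohomology_class_iff)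
  qed
  then show ?thesis
    unfolding cohomology_scale_def using cohomology_class_self[OF f] by blast
qed

end

text \<open>
  The induced map sends a class \<open>X\<close> to the union of the classes \<open>[\<theta> f]\<close> over \<open>f \<in> X\<close>; these all
  agree because \<open>\<theta>\<close> sends \<open>d h\<close> to \<open>d' (\<theta> h)\<close>. On representatives its linearity is that of \<open>\<theta>\<close>.
\<close>

theorem cochain_map_induces_cohomology_morphism:
  assumes src: "linear_differential s C d" and tgt: "linear_differential s' C' d'"
    and lin: "\<And>n. Vector_Spaces.linear s s' (\<theta> n)"
    and mem: "\<And>n f. f \<in> C n \<Longrightarrow> \<theta> n f \<in> C' n"
    and comm: "\<And>n f. f \<in> C n \<Longrightarrow> d' n (\<theta> n f) = \<theta> (Suc n) (d n f)"
  shows "induces_cohomology_morphism s C d s' C' d' \<theta>"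
proof -
  interpret S: linear_differential s C d by (rule src)
  interpret T: linear_differential s' C' d' by (rule tgt)
  interpret \<theta>: Vector_Spaces.linear s s' "\<theta> n" for n by (rule lin)
  define \<Phi> where "\<Phi> n X = (\<Union>f\<in>X. cohomology_class C' d' n (\<theta> n f))" for n X
  have cocycle: "\<theta> n f \<in> cocycles C' d' n" if "f \<in> cocycles C d n" for n f
    using that by (auto simp: cocycles_def mem comm \<theta>.zero)
  have coboundary: "\<theta> n f \<in> coboundaries C' d' n" if "f \<in> coboundaries C d n" for n f
    using that by (cases n) (auto simp: \<theta>.zero mem simp flip: comm)
  have \<Phi>_class: "\<Phi> n (cohomology_class C d n f) = cohomology_class C' d' n (\<theta> n f)"
    if f: "f \<in> cocycles C d n" for n f
  proof -
    have "cohomology_class C' d' n (\<theta> n f') = cohomology_class C' d' n (\<theta> n f)"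
      if f': "f' \<in> cohomology_class C d n f" for f'
    proof -
      have "\<theta> n f - \<theta> n f' \<in> coboundaries C' d' n"
        using f' coboundary[of "f - f'" n] by (simp add: S.mem_cohomology_class_iff \<theta>.diff)
      then show ?thesis
        using f' T.cohomology_class_eq_iff[of "\<theta> n f" n "\<theta> n f'"] cocycle
        by (auto simp: S.mem_cohomology_class_iff)
    qed
    then show ?thesis
      unfolding \<Phi>_def using S.cohomology_class_self[OF f] by blast
  qed
  have "cohomology_linear s C d s' C' d' n (\<Phi> n)" for n
    unfolding cohomology_linear_def
  proof (intro conjI ballI allI)
    fix X assume "X \<in> cohomology C d n"
    then obtain f where f: "f \<in> cocycles C d n" and X: "X = cohomology_class C d n f"
      by (rule S.cohomologyE)
    show "\<Phi> n X \<in> cohomology C' d' n"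
      using f by (simp add: X \<Phi>_class cocycle T.cohomology_class_in_cohomology)
    show "\<Phi> n (cohomology_scale s C d n c X) = cohomology_scale s' C' d' n c (\<Phi> n X)" for c
      using f S.subspace_scale[OF S.subspace_cocycles f]
      by (simp add: X S.cohomology_scale_class T.cohomology_scale_class \<Phi>_class cocycle \<theta>.scale)
    fix Y assume "Y \<in> cohomology C d n"
    then obtain g where g: "g \<in> cocycles C d n" and Y: "Y = cohomology_class C d n g"
      by (rule S.cohomologyE)
    show "\<Phi> n (cohomology_add C d n X Y) = cohomology_add C' d' n (\<Phi> n X) (\<Phi> n Y)"
      using f g S.subspace_add[OF S.subspace_cocycles f g]
      by (simp add: X Y S.cohomology_add_class T.cohomology_add_class \<Phi>_class cocycle \<theta>.add)
  qed
  then show ?thesis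
    unfolding induces_cohomology_morphism_def using mem comm \<Phi>_class by metis
qed

section \<open>Bilinearity of the bracket\<close>

lemma linear_addD: "Vector_Spaces.linear s t f \<Longrightarrow> f (x + y) = f x + f y"
  by (simp add: Vector_Spaces.linear_iff)

lemma linear_scaleD: "Vector_Spaces.linear s t f \<Longrightarrow> f (s c x) = t c (f x)"
  by (simp add: Vector_Spaces.linear_iff)

text \<open>
  The bracket merges two neighbouring arguments into one new entry, which it builds by
  concatenation; hence additivity is needed for such lists instead of for list updates.
\<close>

lemma o_cochains_add_entry:
  assumes "f \<in> o_cochains sA sM n" and "length xs + 1 + length ys = n"
  shows "f (xs @ [u + v] @ ys) = f (xs @ [u] @ ys) + f (xs @ [v] @ ys)"
proof -
  have "Vector_Spaces.linear sM sA (\<lambda>w. f ((xs @ [u] @ ys)[length xs := w]))"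
    using assms unfolding o_cochains_def by (simp del: list_update_append list_update_length)
  from linear_addD[OF this, of u v] show ?thesis
    by simp
qed

context algebra_bimodule
begin

lemma lact_add: "lact (a + b) u = lact a u + lact b u" "lact a (u + v) = lact a u + lact a v"
  and ract_add: "ract (u + v) a = ract u a + ract v a" "ract u (a + b) = ract u a + ract u b"
  by (rule linear_addD[OF lact_linear_left] linear_addD[OF lact_linear_right]
      linear_addD[OF ract_linear_left] linear_addD[OF ract_linear_right])+

lemma lact_scale: "lact (sA c a) u = sM c (lact a u)"
  and ract_scale: "ract u (sA c a) = sM c (ract u a)"
  by (rule linear_scaleD[OF lact_linear_left] linear_scaleD[OF ract_linear_right])+

lemma vector_space_cochains: "vector_space (fun_scale sA)"
  by (rule vector_space_fun_scale) unfold_locales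

lemma linear_o_bracket:
  assumes T: "Vector_Spaces.linear sM sA T"
  shows "Vector_Spaces.linear (fun_scale sA) (fun_scale sA) (o_bracket sA lact ract T n)"
proof -
  interpret T: Vector_Spaces.linear sM sA T by (rule T)
  have add: "o_bracket sA lact ract T n (f + g) =
      o_bracket sA lact ract T n f + o_bracket sA lact ract T n g" for f g
    by (cases n)
      (auto simp: fun_eq_iff Let_def lact_add ract_add T.add T.diff A.scale_right_distrib
        A.scale_right_diff_distrib sum.distrib distrib_left distrib_right algebra_simps
        simp del: power_Suc)
  have scale: "o_bracket sA lact ract T n (fun_scale sA c f) =
      fun_scale sA c (o_bracket sA lact ract T n f)" for c f
    by (cases n)
      (auto simp: fun_eq_iff Let_def fun_scale_def lact_scale ract_scale T.scale T.diff
        A.scale_right_distrib A.scale_right_diff_distrib A.scale_sum_right A.scale_mult_left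
        A.scale_mult_right A.scale_left_commute
        simp del: power_Suc A.scale_scale)
  show ?thesis
    using vector_space_cochains add scale by (simp add: Vector_Spaces.linear_iff)
qed

text \<open>
  In the terms \<open>f (\<dots>, T u\<^sub>i \<cdot> u\<^sub>i\<^sub>+\<^sub>1, \<dots>)\<close> and \<open>f (\<dots>, u\<^sub>i \<cdot> T u\<^sub>i\<^sub>+\<^sub>1, \<dots>)\<close> the operator is
  inside an argument of \<open>f\<close>, and additivity of \<open>f\<close> in that argument splits the two sums
  (\<open>sumL\<close>, \<open>sumR\<close>). In all other terms the operator occurs linearly from outside.
\<close>

lemma o_bracket_add_operator:
  assumes f: "f \<in> o_cochains sA sM n"
  shows "o_bracket sA lact ract (S + T) n f =
    o_bracket sA lact ract S n f + o_bracket sA lact ract T n f"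
proof (cases n)
  case 0
  then show ?thesis
    by (auto simp: fun_eq_iff Let_def algebra_simps)
next
  case (Suc m)
  have entry: "f (take (i - 1) us @ [u + v] @ drop (i + 1) us) =
      f (take (i - 1) us @ [u] @ drop (i + 1) us) + f (take (i - 1) us @ [v] @ drop (i + 1) us)"
    if "length us = n + 1" "i \<in> {1..n}" for us u v i
    using that by (intro o_cochains_add_entry[OF f]) auto
  have sumL: "(\<Sum>i = 1..n. sA ((- 1) ^ (i - 1))
        (f (take (i - 1) us @ [lact ((S + T) (us ! (i - 1))) (us ! i)] @ drop (i + 1) us))) =
      (\<Sum>i = 1..n. sA ((- 1) ^ (i - 1))
        (f (take (i - 1) us @ [lact (S (us ! (i - 1))) (us ! i)] @ drop (i + 1) us))) +
      (\<Sum>i = 1..n. sA ((- 1) ^ (i - 1))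
        (f (take (i - 1) us @ [lact (T (us ! (i - 1))) (us ! i)] @ drop (i + 1) us)))"
    if "length us = n + 1" for us
    unfolding sum.distrib[symmetric] plus_fun_def lact_add
    by (intro sum.cong refl) (simp only: entry[OF that] A.scale_right_distrib)
  have sumR: "(\<Sum>i = 1..n. sA ((- 1) ^ i)
        (f (take (i - 1) us @ [ract (us ! (i - 1)) ((S + T) (us ! i))] @ drop (i + 1) us))) =
      (\<Sum>i = 1..n. sA ((- 1) ^ i)
        (f (take (i - 1) us @ [ract (us ! (i - 1)) (S (us ! i))] @ drop (i + 1) us))) +
      (\<Sum>i = 1..n. sA ((- 1) ^ i)
        (f (take (i - 1) us @ [ract (us ! (i - 1)) (T (us ! i))] @ drop (i + 1) us)))"
    if "length us = n + 1" for us
    unfolding sum.distrib[symmetric] plus_fun_def ract_add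
    by (intro sum.cong refl) (simp only: entry[OF that] A.scale_right_distrib)
  show ?thesis
  proof
    fix us
    show "o_bracket sA lact ract (S + T) n f us =
      (o_bracket sA lact ract S n f + o_bracket sA lact ract T n f) us"
    proof (cases "length us = n + 1")
      case True
      then show ?thesis
        unfolding Suc plus_fun_def[of "o_bracket _ _ _ _ _ _"] o_bracket.simps Let_def
          sumL[OF True, unfolded Suc] sumR[OF True, unfolded Suc]
        by (simp add: A.scale_right_distrib A.scale_right_diff_distrib distrib_left distrib_right
            algebra_simps del: power_Suc sum.cl_ivl_Suc)
    next
      case False
      then show ?thesis by (simp add: Suc)
    qed
  qed
qed

section \<open>The complexes and the total map\<close>

lemma subspace_o_cochains: "module.subspace (fun_scale sA) (o_cochains sA sM n)"
proof -
  interpret F: vector_space "fun_scale sA" by (rule vector_space_cochains)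
  interpret vector_space_pair sM sA ..
  show ?thesis
    by (auto simp: F.subspace_def o_cochains_def fun_scale_def
        intro: linear_compose_add linear_compose_scale_right linear_zero)
qed

lemma subspace_co_cochains:
  "module.subspace (fun_scale (fun_scale sA)) (co_cochains sA sM n)"
proof -
  interpret F: vector_space "fun_scale sA" by (rule vector_space_cochains)
  interpret G: vector_space "fun_scale (fun_scale sA)"
    by (rule vector_space_fun_scale) (rule vector_space_cochains)
  show ?thesis
    using subspace_o_cochains[of n]
    by (auto simp: F.subspace_def G.subspace_def co_cochains_def fun_scale_def[of "fun_scale sA"])
qed

lemma linear_co_diff:
  assumes "Vector_Spaces.linear sM sA T1" "Vector_Spaces.linear sM sA T2"
  shows "Vector_Spaces.linear (fun_scale (fun_scale sA)) (fun_scale (fun_scale sA))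
    (co_diff sA lact ract T1 T2 n)"
proof -
  interpret F: vector_space "fun_scale sA" by (rule vector_space_cochains)
  interpret b1: Vector_Spaces.linear "fun_scale sA" "fun_scale sA" "o_bracket sA lact ract T1 n"
    by (rule linear_o_bracket) (rule assms)
  interpret b2: Vector_Spaces.linear "fun_scale sA" "fun_scale sA" "o_bracket sA lact ract T2 n"
    by (rule linear_o_bracket) (rule assms)
  have "co_diff sA lact ract T1 T2 n (F + G) =
      co_diff sA lact ract T1 T2 n F + co_diff sA lact ract T1 T2 n G" for F G
    by (rule ext) (simp add: co_diff_def b1.add b2.add)
  moreover have "co_diff sA lact ract T1 T2 n (fun_scale (fun_scale sA) c F) =
      fun_scale (fun_scale sA) c (co_diff sA lact ract T1 T2 n F)" for c F
    by (rule ext)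
      (simp add: co_diff_def fun_scale_def[of "fun_scale sA"] b1.scale b2.scale
        F.scale_right_distrib)
  ultimately show ?thesis
    using vector_space_fun_scale[OF vector_space_cochains]
    by (simp add: Vector_Spaces.linear_iff)
qed

lemma linear_total_map:
  "Vector_Spaces.linear (fun_scale (fun_scale sA)) (fun_scale sA)
    (total_map n :: (nat \<Rightarrow> 'm list \<Rightarrow> 'a) \<Rightarrow> 'm list \<Rightarrow> 'a)"
proof -
  interpret F: vector_space "fun_scale sA" by (rule vector_space_cochains)
  have "total_map n (fun_scale (fun_scale sA) c F) = fun_scale sA c (total_map n F)"
    for c and F :: "nat \<Rightarrow> 'm list \<Rightarrow> 'a"
    by (simp add: total_map_def fun_scale_def[of "fun_scale sA"] F.scale_sum_right)
  moreover have "total_map n (F + G) = total_map n F + total_map n G"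
    for F G :: "nat \<Rightarrow> 'm list \<Rightarrow> 'a"
    by (simp add: total_map_def sum.distrib)
  ultimately show ?thesis
    using vector_space_fun_scale[OF vector_space_cochains] vector_space_cochains
    by (simp add: Vector_Spaces.linear_iff)
qed

lemma total_map_in_o_cochains:
  assumes "F \<in> co_cochains sA sM n"
  shows "total_map n F \<in> o_cochains sA sM n"
proof -
  interpret F: vector_space "fun_scale sA" by (rule vector_space_cochains)
  show ?thesis
    using assms unfolding total_map_def co_cochains_def
    by (intro F.subspace_sum[OF subspace_o_cochains]) auto
qed

text \<open>
  The case distinction in \<^const>\<open>co_diff\<close> is the entrywise sum of two families: \<open>[T\<^sub>1, F i]\<close>,
  cut off after \<open>i = n\<close>, and \<open>[T\<^sub>2, F i]\<close>, moved up by one place. Reindexing the second family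
  gives the claim.
\<close>

lemma sum_co_diff:
  "total_map (Suc n) (co_diff sA lact ract T1 T2 n F) =
    (\<Sum>i\<le>n. o_bracket sA lact ract T1 n (F i)) + (\<Sum>i\<le>n. o_bracket sA lact ract T2 n (F i))"
proof -
  let ?b1 = "\<lambda>i. if i \<le> n then o_bracket sA lact ract T1 n (F i) else 0"
  let ?b2 = "\<lambda>i. if i = 0 then 0 else o_bracket sA lact ract T2 n (F (i - 1))"
  have "total_map (Suc n) (co_diff sA lact ract T1 T2 n F) = (\<Sum>i\<le>Suc n. ?b1 i + ?b2 i)"
    unfolding total_map_def by (intro sum.cong refl) (auto simp: co_diff_def le_Suc_eq)
  also have "\<dots> = (\<Sum>i\<le>Suc n. ?b1 i) + (\<Sum>i\<le>Suc n. ?b2 i)"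
    by (rule sum.distrib)
  also have "(\<Sum>i\<le>Suc n. ?b1 i) = (\<Sum>i\<le>n. o_bracket sA lact ract T1 n (F i))"
    by simp
  also have "(\<Sum>i\<le>Suc n. ?b2 i) = (\<Sum>i\<le>n. o_bracket sA lact ract T2 n (F i))"
    by (subst sum.atMost_Suc_shift) simp
  finally show ?thesis .
qed

lemma total_map_co_diff:
  assumes T1: "Vector_Spaces.linear sM sA T1" and T2: "Vector_Spaces.linear sM sA T2"
    and F: "F \<in> co_cochains sA sM n"
  shows "o_bracket sA lact ract (T1 + T2) n (total_map n F) =
    total_map (Suc n) (co_diff sA lact ract T1 T2 n F)"
proof -
  interpret b1: Vector_Spaces.linear "fun_scale sA" "fun_scale sA" "o_bracket sA lact ract T1 n"
    by (rule linear_o_bracket) (rule T1)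
  interpret b2: Vector_Spaces.linear "fun_scale sA" "fun_scale sA" "o_bracket sA lact ract T2 n"
    by (rule linear_o_bracket) (rule T2)
  have "o_bracket sA lact ract (T1 + T2) n (total_map n F) =
      o_bracket sA lact ract T1 n (total_map n F) + o_bracket sA lact ract T2 n (total_map n F)"
    by (rule o_bracket_add_operator) (rule total_map_in_o_cochains[OF F])
  then show ?thesis
    unfolding sum_co_diff by (simp add: total_map_def b1.sum b2.sum)
qed

end

theorem theorem3p5:
  fixes sA :: "'k::field_char_0 \<Rightarrow> 'a::ring \<Rightarrow> 'a"
    and sM :: "'k \<Rightarrow> 'm::ab_group_add \<Rightarrow> 'm"
    and lact :: "'a \<Rightarrow> 'm \<Rightarrow> 'm"
    and ract :: "'m \<Rightarrow> 'a \<Rightarrow> 'm"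
    and T1 T2 :: "'m \<Rightarrow> 'a"
  assumes "algebra_bimodule sA sM lact ract"
    and "compatible_o_operator sA sM lact ract T1 T2"
  shows "induces_cohomology_morphism
    (fun_scale (fun_scale sA)) (co_cochains sA sM) (co_diff sA lact ract T1 T2)
    (fun_scale sA) (o_cochains sA sM) (o_bracket sA lact ract (T1 + T2))
    total_map"
proof -
  interpret algebra_bimodule sA sM lact ract by fact
  have T1: "Vector_Spaces.linear sM sA T1" and T2: "Vector_Spaces.linear sM sA T2"
    using assms(2) by (auto simp: compatible_o_operator_def o_operator_def)
  have T: "Vector_Spaces.linear sM sA (T1 + T2)"
    using total_o_operator[OF assms] by (simp add: o_operator_def)
  show ?thesis
  proof (rule cochain_map_induces_cohomology_morphism)
    show "linear_differential (fun_scale (fun_scale sA)) (co_cochains sA sM)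
        (co_diff sA lact ract T1 T2)"
      by (intro linear_differential.intro linear_differential_axioms.intro
          vector_space_fun_scale vector_space_cochains subspace_co_cochains linear_co_diff T1 T2)
    show "linear_differential (fun_scale sA) (o_cochains sA sM)
        (o_bracket sA lact ract (T1 + T2))"
      by (intro linear_differential.intro linear_differential_axioms.intro
          vector_space_cochains subspace_o_cochains linear_o_bracket T)
  qed (auto intro: linear_total_map total_map_in_o_cochains total_map_co_diff[OF T1 T2])
qed

end
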